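(* Let $n$ be a positive integer, $0\le s\le n$, and $A$ an $n\times n$ matrix. Then $A$ is an extreme point of $\omega_n^s$ if and only if there exist vectors $R,S\in\mathcal{RE}(v_n^s)$ such that $A$ is an extreme point of $\omega_n(R,S)$.
   Context: $\omega_n$ is the set of $n\times n$ nonnegative real matrices with all row and column sums at most $1$; $\omega_n^s$ is the set of $A\in\omega_n$ whose entries sum to $s$. For $R,S\in[0,1]^n$ with equal coordinate sums, $\omega_n(R,S)$ is the set of $A\in\omega_n$ whose row sum vector is $R$ and column sum vector is $S$. $v_n^s\in\mathbb{R}^n$ is the vector whose first $\lfloor s\rfloor$ entries equal $1$, whose next entry (if $\lfloor s\rfloor<n$) equals $s-\lfloor s\rfloor$, and whose remaining entries are $0$; $\mathcal{RE}(v)$ is the set of all rearrangements (coordinate permutations) of $v$. An extreme point of a convex set $C$ is a point of $C$ that is not of the form $\lambda y+(1-\lambda)z$ with $y,z\in C$, $y\ne z$, $0<\lambda<1$. *)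

theory Defs
  imports "HOL-Analysis.Analysis"
begin

definition row_sums :: "real^'n^'n \<Rightarrow> real^'n" where
  "row_sums A = (\<chi> i. \<Sum>j\<in>UNIV. A $ i $ j)"

definition col_sums :: "real^'n^'n \<Rightarrow> real^'n" where
  "col_sums A = (\<chi> j. \<Sum>i\<in>UNIV. A $ i $ j)"

definition doubly_substochastic :: "(real^'n^'n) set" where
  "doubly_substochastic =
     {A. (\<forall>i j. 0 \<le> A $ i $ j) \<and> (\<forall>i. row_sums A $ i \<le> 1) \<and> (\<forall>j. col_sums A $ j \<le> 1)}"

definition doubly_substochastic_total :: "real \<Rightarrow> (real^'n^'n) set" where
  "doubly_substochastic_total s =
     {A \<in> doubly_substochastic. (\<Sum>i\<in>UNIV. \<Sum>j\<in>UNIV. A $ i $ j) = s}"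

(* Intended for R, S in [0,1]^n with equal coordinate sums; for all other R, S the set is empty. *)
definition doubly_substochastic_margins :: "real^'n \<Rightarrow> real^'n \<Rightarrow> (real^'n^'n) set" where
  "doubly_substochastic_margins R S =
     {A \<in> doubly_substochastic. row_sums A = R \<and> col_sums A = S}"

(* The linear order on the index type identifies it with {0, ..., n - 1}. *)
definition index_pos :: "'n::{finite,linorder} \<Rightarrow> nat" where
  "index_pos i = card {j. j < i}"

definition floor_vec :: "real \<Rightarrow> real^'n::{finite,linorder}" where
  "floor_vec s =
     (\<chi> i. if int (index_pos i) < \<lfloor>s\<rfloor> then 1
           else if int (index_pos i) = \<lfloor>s\<rfloor> then s - of_int \<lfloor>s\<rfloor>
           else 0)"

definition rearrangements :: "real^'n \<Rightarrow> (real^'n) set" where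
  "rearrangements v = {w. \<exists>p. p permutes UNIV \<and> w = (\<chi> i. v $ p i)}"

end

theory Submission
  imports Defs
begin

text \<open>
  A vector is a rearrangement of \<open>floor_vec s\<close> iff its entries lie in \<open>[0,1]\<close>, sum to \<open>s\<close>, and at
  most one of them is fractional.  If \<open>A\<close> has such margins, the margins of every segment through
  \<open>A\<close> in the larger polytope are forced (integral sums are extremal, the fractional one is
  determined by the total), which gives the backward direction.

  For the forward direction, a perturbation argument shows that, at an extreme point \<open>A\<close>, the
  active constraints span everything: every matrix agrees on the support of \<open>A\<close> with
  \<open>a\<^sub>i + b\<^sub>j + c\<close>, where \<open>a\<close> and \<open>b\<close> vanish on rows and columns of sum less than 1.  If rows
  \<open>p\<close> and \<open>q\<close> both had fractional sums, apply this to the matrix that is \<open>1\<close> on row \<open>p\<close>,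
  \<open>2\<close> on row \<open>q\<close> and \<open>0\<close> elsewhere.  Unless \<open>c = 1\<close>, the columns with \<open>b\<^sub>j = 1 - c\<close> carry exactly
  the mass of row \<open>p\<close> and of the rows with \<open>a\<^sub>i = -1\<close>; all these columns and rows except \<open>p\<close> have
  sum 1, so the sum of row \<open>p\<close> would be an integer.  Hence \<open>c = 1\<close>, and symmetrically \<open>c = 2\<close>.
\<close>

section \<open>Rearrangements of \<open>floor_vec s\<close> as vectors with at most one fractional
  entry\<close>

definition at_most_one_fractional :: "real^'n \<Rightarrow> bool" where
  "at_most_one_fractional x \<longleftrightarrow>
     (\<forall>i. 0 \<le> x $ i \<and> x $ i \<le> 1) \<and>
     (\<forall>i j. x $ i \<notin> {0, 1} \<longrightarrow> x $ j \<notin> {0, 1} \<longrightarrow> i = j)"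

text \<open>The sum alone determines the multiset of entries, so two such vectors with equal sums
  are rearrangements of each other. The case \<open>s = real CARD('n)\<close> is separate: there
  every entry is 1 and none is left to equal \<open>frac s\<close>, which is 0.\<close>

lemma mset_of_at_most_one_fractional:
  fixes x :: "real^'n"
  assumes x: "at_most_one_fractional x"
  defines "s \<equiv> \<Sum>i\<in>UNIV. x $ i"
  shows "image_mset (($) x) (mset_set UNIV) =
    (if s = real CARD('n) then replicate_mset CARD('n) 1
     else add_mset (frac s) (replicate_mset (nat \<lfloor>s\<rfloor>) 1 + replicate_mset (CARD('n) - 1 - nat \<lfloor>s\<rfloor>) 0))"
proof (cases "\<forall>i. x $ i = 1")
  case True
  then have "s = real CARD('n)" by (simp add: s_def)
  moreover have "image_mset (($) x) (mset_set UNIV) = image_mset (\<lambda>_. 1) (mset_set (UNIV :: 'n set))"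
    using True by (intro image_mset_cong) simp
  ultimately show ?thesis by (simp add: image_mset_const_eq)
next
  case False
  have bounds: "0 \<le> x $ i" "x $ i \<le> 1" for i
    using x by (auto simp: at_most_one_fractional_def)
  \<comment> \<open>\<open>k\<close> is the fractional position if there is one, otherwise any
    position with entry 0; either way \<open>x $ k\<close> turns out to be
    \<open>frac s\<close>.\<close>
  obtain k where k: "x $ k < 1" and others: "\<And>i. i \<noteq> k \<Longrightarrow> x $ i \<in> {0, 1}"
  proof (cases "\<exists>k. x $ k \<notin> {0, 1}")
    case True
    then obtain k where "x $ k \<notin> {0, 1}" by blast
    moreover have "x $ i \<in> {0, 1}" if "i \<noteq> k" for i
      using x calculation that unfolding at_most_one_fractional_def by blast
    moreover have "x $ k < 1" using calculation bounds(2)[of k] by simp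
    ultimately show ?thesis using that by blast
  next
    case all: False
    from False obtain k where "x $ k \<noteq> 1" by blast
    then have "x $ k < 1" using bounds(2)[of k] by simp
    then show ?thesis using that all by blast
  qed
  define J where "J = {i. x $ i = 1}"
  define Z where "Z = - insert k J"
  have "k \<notin> J" using k by (simp add: J_def)
  have zero: "x $ i = 0" if "i \<in> Z" for i
    using others[of i] that by (auto simp: Z_def J_def)
  have UNIV_eq: "UNIV = insert k (J \<union> Z)" by (auto simp: Z_def)
  have disj: "J \<inter> Z = {}" "k \<notin> J \<union> Z" using \<open>k \<notin> J\<close> by (auto simp: Z_def)
  have "s = x $ k + (sum (($) x) J + sum (($) x) Z)"
    unfolding s_def using disj by (subst UNIV_eq) (simp add: sum.union_disjoint)
  also have "sum (($) x) J = real (card J)" by (simp add: J_def)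
  also have "sum (($) x) Z = 0" using zero by simp
  finally have s: "s = x $ k + real (card J)" by simp
  have fl: "\<lfloor>s\<rfloor> = int (card J)"
    using s k bounds(1)[of k] by (intro floor_unique) auto
  have fr: "frac s = x $ k" using s fl by (simp add: frac_def)
  have cardZ: "card Z = CARD('n) - 1 - card J"
    using \<open>k \<notin> J\<close> by (simp add: Z_def Compl_eq_Diff_UNIV card_Diff_subset)
  have "card (insert k J) \<le> CARD('n)" by (rule card_mono) auto
  then have "s \<noteq> real CARD('n)" using s k \<open>k \<notin> J\<close> by simp
  moreover have "mset_set UNIV = add_mset k (mset_set J + mset_set Z)"
    using disj by (subst UNIV_eq) (simp add: mset_set_Union)
  moreover have "image_mset (($) x) (mset_set J) = replicate_mset (card J) 1"
  proof -
    have "image_mset (($) x) (mset_set J) = image_mset (\<lambda>_. 1) (mset_set J)"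
      by (intro image_mset_cong) (simp add: J_def)
    then show ?thesis by (simp add: image_mset_const_eq)
  qed
  moreover have "image_mset (($) x) (mset_set Z) = replicate_mset (card Z) 0"
  proof -
    have "image_mset (($) x) (mset_set Z) = image_mset (\<lambda>_. 0) (mset_set Z)"
      using zero by (intro image_mset_cong) simp
    then show ?thesis by (simp add: image_mset_const_eq)
  qed
  ultimately show ?thesis by (simp add: fl fr cardZ)
qed

text \<open>Counting predecessors is strictly monotone, hence injective, and an injection between
  finite sets of equal size is onto.\<close>

lemma bij_betw_index_pos:
  "bij_betw (index_pos :: 'n::{finite,linorder} \<Rightarrow> nat) UNIV {..<CARD('n)}"
proof -
  have less: "index_pos i < index_pos j" if "i < j" for i j :: 'n
    unfolding index_pos_def using that by (intro psubset_card_mono) auto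
  have inj: "inj (index_pos :: 'n \<Rightarrow> nat)"
    by (rule injI) (metis less less_irrefl linorder_neqE)
  have "index_pos i < CARD('n)" for i :: 'n
    unfolding index_pos_def by (rule psubset_card_mono) auto
  then have "range (index_pos :: 'n \<Rightarrow> nat) \<subseteq> {..<CARD('n)}" by auto
  then have "range (index_pos :: 'n \<Rightarrow> nat) = {..<CARD('n)}"
    using inj by (intro card_subset_eq) (simp_all add: card_image)
  with inj show ?thesis by (simp add: bij_betw_def)
qed

lemma sum_floor_vec:
  assumes "0 \<le> s" and "s \<le> real CARD('n)"
  shows "(\<Sum>i\<in>UNIV. (floor_vec s :: real^'n::{finite,linorder}) $ i) = s"
proof -
  define m where "m = nat \<lfloor>s\<rfloor>"
  have m: "\<lfloor>s\<rfloor> = int m" using assms by (simp add: m_def)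
  have sm: "real m \<le> s" "s < real m + 1"
    using m floor_correct[of s] by auto
  then have "m \<le> CARD('n)" using assms by linarith
  \<comment> \<open>A sum of two conditionals, so that \<open>sum.distrib\<close> separates the ones
    from the fractional entry.\<close>
  define g where "g k = (if k < m then 1 else 0) + (if k = m then s - real m else 0)" for k
  have "(\<Sum>i\<in>UNIV. (floor_vec s :: real^'n::{finite,linorder}) $ i) = (\<Sum>i\<in>(UNIV :: 'n set). g (index_pos i))"
    by (intro sum.cong) (auto simp: floor_vec_def m g_def)
  also have "\<dots> = (\<Sum>k<CARD('n). g k)"
    by (rule sum.reindex_bij_betw[OF bij_betw_index_pos])
  also have "\<dots> = real (card {k. k < CARD('n) \<and> k < m}) + (if m < CARD('n) then s - real m else 0)"
    unfolding g_def by (simp add: sum.distrib sum.If_cases Int_def)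
  also have "{k. k < CARD('n) \<and> k < m} = {..<m}" using \<open>m \<le> CARD('n)\<close> by auto
  \<comment> \<open>If \<open>m = CARD('n)\<close>, no position holds the fractional entry, but then
    \<open>s \<le> real CARD('n)\<close> makes \<open>s - real m\<close> zero.\<close>
  finally show ?thesis using sm assms \<open>m \<le> CARD('n)\<close> by (auto split: if_splits)
qed

lemma at_most_one_fractional_floor_vec:
  "at_most_one_fractional (floor_vec s :: real^'n::{finite,linorder})"
proof -
  have inj: "inj (index_pos :: 'n \<Rightarrow> nat)"
    using bij_betw_index_pos by (rule bij_betw_imp_inj_on)
  have "(floor_vec s :: real^'n::{finite,linorder}) $ i \<notin> {0, 1} \<Longrightarrow> int (index_pos i) = \<lfloor>s\<rfloor>" for i
    by (auto simp: floor_vec_def split: if_splits)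
  moreover have "0 \<le> (floor_vec s :: real^'n::{finite,linorder}) $ i \<and> (floor_vec s :: real^'n::{finite,linorder}) $ i \<le> 1" for i
  proof -
    have "0 \<le> s - of_int \<lfloor>s\<rfloor>" "s - of_int \<lfloor>s\<rfloor> \<le> 1"
      using floor_correct[of s] by linarith+
    then show ?thesis by (simp add: floor_vec_def)
  qed
  ultimately show ?thesis
    unfolding at_most_one_fractional_def by (metis inj injD of_nat_eq_iff)
qed

text \<open>Permuting coordinates preserves both conditions. Conversely, \<open>floor_vec s\<close>
  satisfies them too, so the entry multisets agree, and equal multisets yield a permutation.\<close>

lemma mem_rearrangements_floor_vec_iff:
  fixes x :: "real^'n::{finite,linorder}"
  assumes "0 \<le> s" and "s \<le> real CARD('n)"
  shows "x \<in> rearrangements (floor_vec s) \<longleftrightarrow> at_most_one_fractional x \<and> (\<Sum>i\<in>UNIV. x $ i) = s"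
proof
  let ?v = "floor_vec s :: real^'n::{finite,linorder}"
  assume "x \<in> rearrangements ?v"
  then obtain p where p: "p permutes UNIV" and x: "\<And>i. x $ i = ?v $ p i"
    by (auto simp: rearrangements_def)
  have "at_most_one_fractional x"
    using at_most_one_fractional_floor_vec[of s, where 'n='n] permutes_inj[OF p]
    unfolding at_most_one_fractional_def x by (meson injD)
  moreover have "(\<Sum>i\<in>UNIV. x $ i) = (\<Sum>i\<in>UNIV. ?v $ i)"
    unfolding x using sum.permute[OF p, of "($) ?v"] by (simp add: o_def)
  ultimately show "at_most_one_fractional x \<and> (\<Sum>i\<in>UNIV. x $ i) = s"
    using sum_floor_vec[OF assms] by simp
next
  let ?v = "floor_vec s :: real^'n::{finite,linorder}"
  assume x: "at_most_one_fractional x \<and> (\<Sum>i\<in>UNIV. x $ i) = s"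
  have "image_mset (($) x) (mset_set UNIV) = image_mset (($) ?v) (mset_set UNIV)"
    using x mset_of_at_most_one_fractional[of x] sum_floor_vec[OF assms]
      mset_of_at_most_one_fractional[OF at_most_one_fractional_floor_vec[of s, where 'n='n]]
    by simp
  then obtain p where "p permutes UNIV" "\<forall>i\<in>UNIV. x $ i = ?v $ p i"
    using image_mset_eq_implies_permutes[OF finite] by metis
  then show "x \<in> rearrangements ?v"
    by (auto simp: rearrangements_def vec_eq_iff)
qed

section \<open>Row sums, column sums and transposition\<close>

lemma row_sums_add_scaleR: "row_sums (a *\<^sub>R B + b *\<^sub>R C) = a *\<^sub>R row_sums B + b *\<^sub>R row_sums C"
  by (simp add: row_sums_def vec_eq_iff sum.distrib sum_distrib_left)

lemma col_sums_add_scaleR: "col_sums (a *\<^sub>R B + b *\<^sub>R C) = a *\<^sub>R col_sums B + b *\<^sub>R col_sums C"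
  by (simp add: col_sums_def vec_eq_iff sum.distrib sum_distrib_left)

lemma row_sums_nth: "row_sums A $ i = (\<Sum>j\<in>UNIV. A $ i $ j)"
  by (simp add: row_sums_def)

lemma col_sums_nth: "col_sums A $ j = (\<Sum>i\<in>UNIV. A $ i $ j)"
  by (simp add: col_sums_def)

lemma row_sums_transpose: "row_sums (transpose A) = col_sums A"
  by (simp add: row_sums_def col_sums_def transpose_def)

lemma col_sums_transpose: "col_sums (transpose A) = row_sums A"
  by (simp add: row_sums_def col_sums_def transpose_def)

lemma total_row_sums: "(\<Sum>i\<in>UNIV. \<Sum>j\<in>UNIV. A $ i $ j) = (\<Sum>i\<in>UNIV. row_sums A $ i)"
  by (simp add: row_sums_def)

lemma total_col_sums: "(\<Sum>i\<in>UNIV. \<Sum>j\<in>UNIV. A $ i $ j) = (\<Sum>j\<in>UNIV. col_sums A $ j)"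
  unfolding col_sums_nth by (rule sum.swap)

lemma doubly_substochastic_bounds:
  assumes "A \<in> doubly_substochastic"
  shows "0 \<le> A $ i $ j" "0 \<le> row_sums A $ i" "row_sums A $ i \<le> 1"
    "0 \<le> col_sums A $ j" "col_sums A $ j \<le> 1"
  using assms by (auto simp: doubly_substochastic_def row_sums_nth col_sums_nth intro!: sum_nonneg)

lemma transpose_mem_doubly_substochastic_total:
  "transpose A \<in> doubly_substochastic_total s \<longleftrightarrow> A \<in> doubly_substochastic_total s"
proof -
  have "(\<forall>i j. 0 \<le> transpose A $ i $ j) \<longleftrightarrow> (\<forall>i j. 0 \<le> A $ i $ j)"
    by (auto simp: transpose_def)
  moreover have "(\<Sum>i\<in>UNIV. \<Sum>j\<in>UNIV. transpose A $ i $ j) = (\<Sum>i\<in>UNIV. \<Sum>j\<in>UNIV. A $ i $ j)"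
    by (simp add: total_row_sums[of "transpose A"] row_sums_transpose total_col_sums[of A])
  ultimately show ?thesis
    by (auto simp: doubly_substochastic_total_def doubly_substochastic_def row_sums_transpose col_sums_transpose)
qed

text \<open>Transposition is a linear involution preserving the polytope. This carries the result on
  row sums over to column sums.\<close>

lemma transpose_extreme_point_of_doubly_substochastic_total:
  fixes A :: "real^'n^'n"
  assumes "A extreme_point_of doubly_substochastic_total s"
  shows "transpose A extreme_point_of doubly_substochastic_total s"
  unfolding extreme_point_of_def
proof (intro conjI ballI notI)
  show "transpose A \<in> doubly_substochastic_total s"
    using assms by (simp add: extreme_point_of_def transpose_mem_doubly_substochastic_total)
next
  fix B C :: "real^'n^'n"
  assume B: "B \<in> doubly_substochastic_total s" and C: "C \<in> doubly_substochastic_total s"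
    and "transpose A \<in> open_segment B C"
  have lin: "linear (transpose :: real^'n^'n \<Rightarrow> real^'n^'n)"
    by (rule linearI) (simp_all add: transpose_def vec_eq_iff)
  have inj: "inj (transpose :: real^'n^'n \<Rightarrow> real^'n^'n)"
    by (rule injI) (metis transpose_transpose)
  have "transpose (transpose A) \<in> transpose ` open_segment B C"
    using \<open>transpose A \<in> open_segment B C\<close> by (rule imageI)
  then have "A \<in> open_segment (transpose B) (transpose C)"
    by (simp add: open_segment_linear_image[OF lin inj] transpose_transpose)
  then show False
    using assms B C by (auto simp: extreme_point_of_def transpose_mem_doubly_substochastic_total)
qed

section \<open>Perturbation at an extreme point\<close>

text \<open>A slack constraint survives small \<open>t\<close> of either sign by continuity; a tight
  one is required to have slope 0.\<close>

lemma eventually_at_0_affine_nonneg: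
  fixes u v :: real
  assumes "0 \<le> u" and "u = 0 \<Longrightarrow> v = 0"
  shows "\<forall>\<^sub>F t in at 0. 0 \<le> u + t * v"
proof (cases "u = 0")
  case True
  then show ?thesis using assms by simp
next
  case False
  have "((\<lambda>t. u + t * v) \<longlongrightarrow> u + 0 * v) (at 0)"
    by (intro tendsto_intros)
  then have "\<forall>\<^sub>F t in at 0. 0 < u + t * v"
    using False assms by (intro order_tendstoD) auto
  then show ?thesis by (rule eventually_mono) simp
qed

text \<open>\<open>E\<close> does not move the total or any constraint tight at \<open>A\<close>,
  and the finitely many slack constraints survive for small \<open>t\<close>.\<close>

lemma eventually_perturbation_mem_total:
  fixes A E :: "real^'n^'n"
  assumes A: "A \<in> doubly_substochastic_total s"
    and supp: "\<And>i j. A $ i $ j = 0 \<Longrightarrow> E $ i $ j = 0"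
    and rows: "\<And>i. row_sums A $ i = 1 \<Longrightarrow> row_sums E $ i = 0"
    and cols: "\<And>j. col_sums A $ j = 1 \<Longrightarrow> col_sums E $ j = 0"
    and total: "(\<Sum>i\<in>UNIV. \<Sum>j\<in>UNIV. E $ i $ j) = 0"
  shows "\<forall>\<^sub>F t in at 0. A + t *\<^sub>R E \<in> doubly_substochastic_total s"
proof -
  have A': "A \<in> doubly_substochastic" and tot: "(\<Sum>i\<in>UNIV. \<Sum>j\<in>UNIV. A $ i $ j) = s"
    using A by (auto simp: doubly_substochastic_total_def)
  note b = doubly_substochastic_bounds[OF A']
  have "\<forall>\<^sub>F t in at 0. \<forall>i j. 0 \<le> A $ i $ j + t * E $ i $ j"
    by (intro eventually_all_finite eventually_at_0_affine_nonneg b supp)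
  moreover have "\<forall>\<^sub>F t in at 0. \<forall>i. 0 \<le> (1 - row_sums A $ i) + t * (- row_sums E $ i)"
    using b rows by (intro eventually_all_finite eventually_at_0_affine_nonneg) auto
  moreover have "\<forall>\<^sub>F t in at 0. \<forall>j. 0 \<le> (1 - col_sums A $ j) + t * (- col_sums E $ j)"
    using b cols by (intro eventually_all_finite eventually_at_0_affine_nonneg) auto
  ultimately show ?thesis
  proof eventually_elim
    case (elim t)
    have "(\<Sum>i\<in>UNIV. \<Sum>j\<in>UNIV. (A + t *\<^sub>R E) $ i $ j) = s"
      using tot total by (simp add: sum.distrib sum_distrib_left[symmetric])
    with elim show ?case
      using row_sums_add_scaleR[of 1 A t E] col_sums_add_scaleR[of 1 A t E]
      by (simp add: doubly_substochastic_total_def doubly_substochastic_def algebra_simps)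
  qed
qed

text \<open>Linear duality: the matrices of this form are the span of the normals of the tight
  constraints (matrix units at zeros of \<open>A\<close>, indicators of rows and columns of sum 1,
  the all-ones matrix). Were the span proper, a nonzero \<open>E\<close> orthogonal to it would put
  \<open>A\<close> strictly inside a segment.\<close>

lemma extreme_point_decomposition:
  fixes A M :: "real^'n^'n"
  assumes A: "A extreme_point_of doubly_substochastic_total s"
  obtains a b :: "'n \<Rightarrow> real" and c :: real where
    "\<And>i. row_sums A $ i \<noteq> 1 \<Longrightarrow> a i = 0" "\<And>j. col_sums A $ j \<noteq> 1 \<Longrightarrow> b j = 0"
    "\<And>i j. A $ i $ j \<noteq> 0 \<Longrightarrow> M $ i $ j = a i + b j + c"
proof -
  define P where "P a b c M \<longleftrightarrow> (\<forall>i. row_sums A $ i \<noteq> 1 \<longrightarrow> a i = 0) \<and>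
    (\<forall>j. col_sums A $ j \<noteq> 1 \<longrightarrow> b j = 0) \<and>
    (\<forall>i j. A $ i $ j \<noteq> 0 \<longrightarrow> M $ i $ j = a i + b j + c)"
    for a b :: "'n \<Rightarrow> real" and c :: real and M :: "real^'n^'n"
  define U where "U = {M. \<exists>a b c. P a b c M}"
  have "subspace U"
    unfolding subspace_def
  proof (intro conjI ballI allI)
    have "P (\<lambda>_. 0) (\<lambda>_. 0) 0 0" by (simp add: P_def)
    then show "0 \<in> U" by (auto simp: U_def)
  next
    fix M N assume "M \<in> U" "N \<in> U"
    then obtain a b c a' b' c' where "P a b c M" "P a' b' c' N" by (auto simp: U_def)
    then have "P (\<lambda>i. a i + a' i) (\<lambda>j. b j + b' j) (c + c') (M + N)"
      by (simp add: P_def)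
    then show "M + N \<in> U" by (auto simp: U_def)
  next
    fix k M assume "M \<in> U"
    then obtain a b c where "P a b c M" by (auto simp: U_def)
    then have "P (\<lambda>i. k * a i) (\<lambda>j. k * b j) (k * c) (k *\<^sub>R M)"
      by (simp add: P_def algebra_simps)
    then show "k *\<^sub>R M \<in> U" by (auto simp: U_def)
  qed
  then have span: "span U = U" by (simp add: span_eq_iff)
  have "U = UNIV"
  proof (rule ccontr)
    assume "U \<noteq> UNIV"
    then obtain E where "E \<noteq> 0" and orth: "\<And>M. M \<in> U \<Longrightarrow> E \<bullet> M = 0"
      using span_not_UNIV_orthogonal[of U] span by auto
    have E_inner: "E \<bullet> M = (\<Sum>i\<in>UNIV. \<Sum>j\<in>UNIV. E $ i $ j * M $ i $ j)" for M
      by (simp add: inner_vec_def)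
    \<comment> \<open>Testing orthogonality against each kind of normal yields the hypotheses of the
      perturbation lemma.\<close>
    have supp: "E $ i $ j = 0" if "A $ i $ j = 0" for i j
    proof -
      have "P (\<lambda>_. 0) (\<lambda>_. 0) 0 (axis i (axis j 1))"
        using that by (auto simp: P_def axis_def)
      then show ?thesis using orth[of "axis i (axis j 1)"]
        by (auto simp: U_def inner_axis)
    qed
    have rows: "row_sums E $ i = 0" if "row_sums A $ i = 1" for i
    proof -
      have "P (\<lambda>k. if k = i then 1 else 0) (\<lambda>_. 0) 0 (\<chi> k l. if k = i then 1 else 0)"
        using that by (auto simp: P_def)
      then have "E \<bullet> (\<chi> k l. if k = i then 1 else 0) = 0" using orth by (auto simp: U_def)
      then show ?thesis
        \<comment> \<open>The row indicator depends on the outer index; swapping brings it under the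
          inner sum, where it collapses.\<close>
        unfolding E_inner by (subst (asm) sum.swap) (simp add: row_sums_nth if_distrib[of "\<lambda>x. _ * x"] cong: if_cong)
    qed
    have cols: "col_sums E $ j = 0" if "col_sums A $ j = 1" for j
    proof -
      have "P (\<lambda>_. 0) (\<lambda>l. if l = j then 1 else 0) 0 (\<chi> k l. if l = j then 1 else 0)"
        using that by (auto simp: P_def)
      then have "E \<bullet> (\<chi> k l. if l = j then 1 else 0) = 0" using orth by (auto simp: U_def)
      then show ?thesis
        by (simp add: E_inner col_sums_nth if_distrib[of "\<lambda>x. _ * x"] cong: if_cong)
    qed
    have "P (\<lambda>_. 0) (\<lambda>_. 0) 1 (\<chi> k l. 1)" by (simp add: P_def)
    then have "E \<bullet> (\<chi> k l. 1) = 0" using orth by (auto simp: U_def)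
    then have total: "(\<Sum>i\<in>UNIV. \<Sum>j\<in>UNIV. E $ i $ j) = 0" by (simp add: E_inner)
    have mem: "A \<in> doubly_substochastic_total s"
      using A by (simp add: extreme_point_of_def)
    have "\<forall>\<^sub>F t in at 0. A + t *\<^sub>R E \<in> doubly_substochastic_total s"
      by (rule eventually_perturbation_mem_total[OF mem supp rows cols total])
    moreover have "\<forall>\<^sub>F t in at 0. A + t *\<^sub>R (- E) \<in> doubly_substochastic_total s"
      using supp rows cols total
      by (intro eventually_perturbation_mem_total[OF mem])
        (simp_all add: row_sums_nth col_sums_nth sum_negf)
    \<comment> \<open>A single nonzero \<open>t\<close> must serve both \<open>E\<close> and
      \<open>- E\<close>, so that \<open>A\<close> is the midpoint of two distinct points.\<close>
    moreover have "\<forall>\<^sub>F t in at (0::real). t \<noteq> 0"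
      by (rule eventually_neq_at_within)
    ultimately have "\<forall>\<^sub>F t in at 0. t \<noteq> 0 \<and> A + t *\<^sub>R E \<in> doubly_substochastic_total s \<and>
        A + t *\<^sub>R (- E) \<in> doubly_substochastic_total s"
      by eventually_elim simp
    then obtain t :: real where t: "t \<noteq> 0" "A + t *\<^sub>R E \<in> doubly_substochastic_total s"
        "A + t *\<^sub>R (- E) \<in> doubly_substochastic_total s"
      using eventually_happens[of _ "at (0::real)"] by auto
    have "A = midpoint (A + t *\<^sub>R E) (A + t *\<^sub>R (- E))"
      by (simp add: midpoint_def scaleR_2[symmetric])
    moreover have "A + t *\<^sub>R E \<noteq> A + t *\<^sub>R (- E)"
      using t \<open>E \<noteq> 0\<close> by (simp add: eq_neg_iff_add_eq_0 scaleR_2[symmetric])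
    ultimately have "A \<in> open_segment (A + t *\<^sub>R E) (A + t *\<^sub>R (- E))"
      by (metis midpoint_in_open_segment)
    then show False using A t by (auto simp: extreme_point_of_def)
  qed
  then have "M \<in> U" by simp
  then obtain a b c where "P a b c M" by (auto simp: U_def)
  then show ?thesis using that by (auto simp: P_def)
qed

section \<open>Fractional row sums of an extreme point\<close>

text \<open>Double counting of the mass in the columns of \<open>J\<close>: if
  \<open>c \<noteq> x\<close>, it equals both \<open>card J\<close> and the sum of row
  \<open>p\<close> plus \<open>card I\<close>, making that row sum an integer. The values
  \<open>x\<close> and \<open>y\<close> are kept general so that the roles of \<open>p\<close> and
  \<open>q\<close> can be exchanged.\<close>

lemma decomposition_offset:
  fixes A :: "real^'n^'n" and a b :: "'n \<Rightarrow> real"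
  assumes a: "\<And>i. row_sums A $ i \<noteq> 1 \<Longrightarrow> a i = 0"
    and b: "\<And>j. col_sums A $ j \<noteq> 1 \<Longrightarrow> b j = 0"
    and p: "\<And>j. A $ p $ j \<noteq> 0 \<Longrightarrow> a p + b j + c = x"
    and q: "\<And>j. A $ q $ j \<noteq> 0 \<Longrightarrow> a q + b j + c = y"
    and others: "\<And>i j. i \<noteq> p \<Longrightarrow> i \<noteq> q \<Longrightarrow> A $ i $ j \<noteq> 0 \<Longrightarrow> a i + b j + c = 0"
    and fractional: "row_sums A $ p \<notin> \<int>" "row_sums A $ q \<noteq> 1"
    and "x \<noteq> 0" "x \<noteq> y"
  shows "c = x"
proof (rule ccontr)
  assume "c \<noteq> x"
  have "row_sums A $ p \<noteq> 1" using fractional by (metis Ints_1)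
  then have ap: "a p = 0" and aq: "a q = 0" using a fractional by auto
  \<comment> \<open>Since \<open>a p = 0\<close>, the support of row \<open>p\<close> lies in
    \<open>J\<close>. A row outside \<open>p\<close>, \<open>q\<close> can meet \<open>J\<close> in
    its support only if its \<open>a i\<close> is \<open>- x\<close>, and then its whole support
    lies in \<open>J\<close>.\<close>
  define J where "J = {j. b j = x - c}"
  define I where "I = {i. i \<noteq> p \<and> i \<noteq> q \<and> a i = - x}"
  \<comment> \<open>On \<open>J\<close> the value \<open>b j = x - c\<close> is nonzero, so the
    column sum must be 1; likewise \<open>a i = - x\<close> is nonzero on \<open>I\<close>.\<close>
  have J1: "col_sums A $ j = 1" if "j \<in> J" for j
    using that b[of j] \<open>c \<noteq> x\<close> by (auto simp: J_def)
  have I1: "row_sums A $ i = 1" if "i \<in> I" for i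
    using that a[of i] \<open>x \<noteq> 0\<close> by (auto simp: I_def)
  have in_J: "(\<Sum>j\<in>J. A $ i $ j) = row_sums A $ i" if "i \<in> insert p I" for i
    unfolding row_sums_nth
  proof (rule sum.mono_neutral_left)
    show "\<forall>j\<in>UNIV - J. A $ i $ j = 0"
      using that p others ap by (force simp: I_def J_def)
  qed auto
  \<comment> \<open>Row \<open>q\<close> avoids \<open>J\<close>, since its support has
    \<open>b j = y - c\<close> and \<open>x \<noteq> y\<close>.\<close>
  have out_J: "(\<Sum>j\<in>J. A $ i $ j) = 0" if "i \<notin> insert p I" for i
  proof (rule sum.neutral, rule ballI, rule ccontr)
    fix j assume j: "j \<in> J" "A $ i $ j \<noteq> 0"
    then show False
      using that q[of j] others[of i j] aq \<open>x \<noteq> y\<close> by (cases "i = q") (auto simp: I_def J_def)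
  qed
  have "real (card J) = (\<Sum>j\<in>J. col_sums A $ j)" using J1 by simp
  also have "\<dots> = (\<Sum>i\<in>UNIV. \<Sum>j\<in>J. A $ i $ j)"
    unfolding col_sums_nth by (rule sum.swap)
  also have "\<dots> = (\<Sum>i\<in>insert p I. \<Sum>j\<in>J. A $ i $ j)"
    using out_J by (intro sum.mono_neutral_right) auto
  also have "\<dots> = (\<Sum>i\<in>insert p I. row_sums A $ i)"
    using in_J by (intro sum.cong) auto
  also have "\<dots> = row_sums A $ p + real (card I)"
    using I1 by (simp add: I_def)
  finally have "row_sums A $ p = of_int (int (card J) - int (card I))" by simp
  then show False using fractional(1) by (metis Ints_of_int)
qed

lemma extreme_point_row_sums:
  fixes A :: "real^'n^'n"
  assumes A: "A extreme_point_of doubly_substochastic_total s"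
  shows "at_most_one_fractional (row_sums A)"
  unfolding at_most_one_fractional_def
proof (intro conjI allI impI)
  have mem: "A \<in> doubly_substochastic"
    using A by (simp add: extreme_point_of_def doubly_substochastic_total_def)
  note bounds = doubly_substochastic_bounds[OF mem]
  show "0 \<le> row_sums A $ i" "row_sums A $ i \<le> 1" for i
    using bounds by auto
  fix p q assume pq: "row_sums A $ p \<notin> {0, 1}" "row_sums A $ q \<notin> {0, 1}"
  have not_int: "row_sums A $ i \<notin> \<int>" if "row_sums A $ i \<notin> {0, 1}" for i
  proof
    assume "row_sums A $ i \<in> \<int>"
    then obtain k :: int where k: "row_sums A $ i = of_int k" by (rule Ints_cases)
    then have "0 \<le> k" "k \<le> 1" using bounds(2,3)[of i] by auto
    then have "k = 0 \<or> k = 1" by auto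
    then show False using that k by auto
  qed
  show "p = q"
  proof (rule ccontr)
    assume "p \<noteq> q"
    \<comment> \<open>Two distinct nonzero values, as \<open>decomposition_offset\<close> demands
      for either order of \<open>p\<close> and \<open>q\<close>; the two orders give contradictory
      values of \<open>c\<close>.\<close>
    define M :: "real^'n^'n" where "M = (\<chi> i j. if i = p then 1 else if i = q then 2 else 0)"
    obtain a b c where ab: "\<And>i. row_sums A $ i \<noteq> 1 \<Longrightarrow> a i = 0" "\<And>j. col_sums A $ j \<noteq> 1 \<Longrightarrow> b j = 0"
      and eq: "\<And>i j. A $ i $ j \<noteq> 0 \<Longrightarrow> M $ i $ j = a i + b j + c"
      by (rule extreme_point_decomposition[OF A, of M]) blast
    then have eq: "a i + b j + c = (if i = p then 1 else if i = q then 2 else 0)"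
      if "A $ i $ j \<noteq> 0" for i j
      using that by (simp add: M_def)
    have ints: "row_sums A $ p \<notin> \<int>" "row_sums A $ q \<notin> \<int>"
      using not_int pq by auto
    have ones: "row_sums A $ p \<noteq> 1" "row_sums A $ q \<noteq> 1"
      using pq by auto
    have "c = 1"
      by (rule decomposition_offset[OF ab, where p = p and q = q and c = c and x = 1 and y = 2])
        (use \<open>p \<noteq> q\<close> ints ones in \<open>auto simp: eq\<close>)
    moreover have "c = 2"
      by (rule decomposition_offset[OF ab, where p = q and q = p and c = c and x = 2 and y = 1])
        (use \<open>p \<noteq> q\<close> ints ones in \<open>auto simp: eq\<close>)
    ultimately show False by simp
  qed
qed

section \<open>Margins along a segment\<close>

text \<open>The values 0 and 1 are extreme in the unit interval, so they are forced on
  \<open>y\<close>; the one remaining coordinate follows from the sum. The parameter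
  \<open>u\<close> is used instead of \<open>open_segment\<close> because distinct matrices may have
  equal margins.\<close>

lemma at_most_one_fractional_segment:
  fixes x y z :: "real^'n"
  assumes x: "at_most_one_fractional x" and eq: "x = (1 - u) *\<^sub>R y + u *\<^sub>R z" and u: "0 < u" "u < 1"
    and y: "\<And>i. 0 \<le> y $ i \<and> y $ i \<le> 1" and z: "\<And>i. 0 \<le> z $ i \<and> z $ i \<le> 1"
    and sum: "(\<Sum>i\<in>UNIV. y $ i) = (\<Sum>i\<in>UNIV. x $ i)"
  shows "y = x"
proof -
  have xi: "x $ i = (1 - u) * y $ i + u * z $ i" for i by (simp add: eq)
  have integral: "y $ i = x $ i" if "x $ i \<in> {0, 1}" for i
  proof (cases "x $ i = 0")
    case True
    then have "(1 - u) * y $ i = 0"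
      using xi[of i] u y[of i] z[of i] by (smt (verit) mult_nonneg_nonneg)
    then show ?thesis using True u by simp
  next
    case False
    with that have "x $ i = 1" by simp
    \<comment> \<open>The gaps to 1 are nonnegative and their weighted sum vanishes, so each
      vanishes.\<close>
    then have "(1 - u) * (1 - y $ i) + u * (1 - z $ i) = 0"
      using xi[of i] by (simp add: algebra_simps)
    moreover have "0 \<le> (1 - u) * (1 - y $ i)" "0 \<le> u * (1 - z $ i)"
      using u y[of i] z[of i] by simp_all
    ultimately have "(1 - u) * (1 - y $ i) = 0" by linarith
    then show ?thesis using \<open>x $ i = 1\<close> u by simp
  qed
  have "y $ k = x $ k" for k
  proof (cases "x $ k \<in> {0, 1}")
    case False
    then have "y $ i = x $ i" if "i \<noteq> k" for i
      using x integral that unfolding at_most_one_fractional_def by blast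
    then have "(\<Sum>i\<in>UNIV - {k}. y $ i) = (\<Sum>i\<in>UNIV - {k}. x $ i)" by simp
    then show ?thesis using sum by (simp add: sum.remove[of UNIV k])
  qed (rule integral)
  then show ?thesis by (simp add: vec_eq_iff)
qed

text \<open>Row and column sums are linear, so they turn the segment into convex combinations of
  margins. The statement for \<open>C\<close> follows by exchanging the endpoints.\<close>

lemma segment_mem_doubly_substochastic_margins:
  fixes A B C :: "real^'n^'n"
  assumes rows: "at_most_one_fractional (row_sums A)" and cols: "at_most_one_fractional (col_sums A)"
    and A: "A \<in> doubly_substochastic_total s" and B: "B \<in> doubly_substochastic_total s"
    and C: "C \<in> doubly_substochastic_total s" and seg: "A \<in> open_segment B C"
  shows "B \<in> doubly_substochastic_margins (row_sums A) (col_sums A)"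
proof -
  obtain u where u: "0 < u" "u < 1" and eq: "A = (1 - u) *\<^sub>R B + u *\<^sub>R C"
    using seg by (auto simp: in_segment)
  have B': "B \<in> doubly_substochastic" and C': "C \<in> doubly_substochastic"
    using B C by (auto simp: doubly_substochastic_total_def)
  have tot: "(\<Sum>i\<in>UNIV. \<Sum>j\<in>UNIV. B $ i $ j) = (\<Sum>i\<in>UNIV. \<Sum>j\<in>UNIV. A $ i $ j)"
    using A B by (simp add: doubly_substochastic_total_def)
  have "row_sums A = (1 - u) *\<^sub>R row_sums B + u *\<^sub>R row_sums C"
    unfolding eq by (rule row_sums_add_scaleR)
  then have "row_sums B = row_sums A"
    using at_most_one_fractional_segment[OF rows _ u] tot
      doubly_substochastic_bounds[OF B'] doubly_substochastic_bounds[OF C']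
    by (simp add: total_row_sums)
  moreover have "col_sums A = (1 - u) *\<^sub>R col_sums B + u *\<^sub>R col_sums C"
    unfolding eq by (rule col_sums_add_scaleR)
  then have "col_sums B = col_sums A"
    using at_most_one_fractional_segment[OF cols _ u] tot
      doubly_substochastic_bounds[OF B'] doubly_substochastic_bounds[OF C']
    by (simp add: total_col_sums)
  ultimately show ?thesis
    using B' by (simp add: doubly_substochastic_margins_def)
qed

theorem theorem5p7:
  fixes A :: "real^'n::{finite,linorder}^'n::{finite,linorder}" and s :: real
  assumes "0 \<le> s" and "s \<le> real CARD('n)"
  shows "A extreme_point_of doubly_substochastic_total s \<longleftrightarrow>
         (\<exists>R \<in> rearrangements (floor_vec s). \<exists>S \<in> rearrangements (floor_vec s).
            A extreme_point_of doubly_substochastic_margins R S)"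
proof
  assume A: "A extreme_point_of doubly_substochastic_total s"
  have mem: "A \<in> doubly_substochastic_total s"
    using A by (simp add: extreme_point_of_def)
  then have total: "(\<Sum>i\<in>UNIV. \<Sum>j\<in>UNIV. A $ i $ j) = s"
    by (simp add: doubly_substochastic_total_def)
  have R: "row_sums A \<in> rearrangements (floor_vec s)"
    using extreme_point_row_sums[OF A] total
    by (simp add: mem_rearrangements_floor_vec_iff[OF assms] total_row_sums)
  have S: "col_sums A \<in> rearrangements (floor_vec s)"
    using extreme_point_row_sums[OF transpose_extreme_point_of_doubly_substochastic_total[OF A]] total
    by (simp add: mem_rearrangements_floor_vec_iff[OF assms] row_sums_transpose total_col_sums)
  \<comment> \<open>The polytope with the margins of \<open>A\<close> lies inside the one with total
    \<open>s\<close>, and an extreme point of a set stays extreme in any subset containing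
    it.\<close>
  have "B \<in> doubly_substochastic_total s"
    if "B \<in> doubly_substochastic_margins (row_sums A) (col_sums A)" for B
    using that total
    by (auto simp: doubly_substochastic_margins_def doubly_substochastic_total_def total_row_sums)
  moreover have "A \<in> doubly_substochastic_margins (row_sums A) (col_sums A)"
    using mem by (simp add: doubly_substochastic_margins_def doubly_substochastic_total_def)
  ultimately have "A extreme_point_of doubly_substochastic_margins (row_sums A) (col_sums A)"
    using A by (simp add: extreme_point_of_def)
  then show "\<exists>R \<in> rearrangements (floor_vec s). \<exists>S \<in> rearrangements (floor_vec s).
      A extreme_point_of doubly_substochastic_margins R S"
    using R S by blast
next
  assume "\<exists>R \<in> rearrangements (floor_vec s). \<exists>S \<in> rearrangements (floor_vec s).
      A extreme_point_of doubly_substochastic_margins R S"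
  then obtain R S where RS: "R \<in> rearrangements (floor_vec s)" "S \<in> rearrangements (floor_vec s)"
    and A: "A extreme_point_of doubly_substochastic_margins R S" by blast
  have mem: "A \<in> doubly_substochastic" and R: "R = row_sums A" and S: "S = col_sums A"
    using A by (auto simp: extreme_point_of_def doubly_substochastic_margins_def)
  have rows: "at_most_one_fractional (row_sums A)" and cols: "at_most_one_fractional (col_sums A)"
    and total: "(\<Sum>i\<in>UNIV. row_sums A $ i) = s"
    using RS unfolding R S by (auto simp: mem_rearrangements_floor_vec_iff[OF assms])
  have memA: "A \<in> doubly_substochastic_total s"
    using mem total by (simp add: doubly_substochastic_total_def total_row_sums)
  \<comment> \<open>Both endpoints of such a segment would already have margins \<open>R\<close> and
    \<open>S\<close>, against extremality in the smaller polytope.\<close>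
  have "A \<notin> open_segment B C"
    if B: "B \<in> doubly_substochastic_total s" and C: "C \<in> doubly_substochastic_total s" for B C
  proof
    assume seg: "A \<in> open_segment B C"
    have "B \<in> doubly_substochastic_margins R S" "C \<in> doubly_substochastic_margins R S"
      unfolding R S
      using segment_mem_doubly_substochastic_margins[OF rows cols memA B C seg]
        segment_mem_doubly_substochastic_margins[OF rows cols memA C B] seg
      by (simp_all add: open_segment_commute)
    then show False using A seg by (simp add: extreme_point_of_def)
  qed
  with memA show "A extreme_point_of doubly_substochastic_total s"
    by (simp add: extreme_point_of_def)
qed

end
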